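(* Let $0\le\alpha\le 1$ and $\beta=1-\alpha$. Let $G_1$ be a simple connected $k_1$-regular graph with $n_1$ vertices and $m_1$ edges, and let $G_2$ be any simple connected graph with $n_2$ vertices. Let $G=G_1\lozenge G_2$ be their edge corona. Then for $\nu$ not a pole of $\Gamma_{A_\alpha(G_2)}(\nu-2\alpha)$, $$f_{A_\alpha(G)}(\nu)=\bigl(f_{A_\alpha(G_2)}(\nu-2\alpha)\bigr)^{m_1}\cdot f_{A_\alpha(G_1)}\!\left(\frac{\nu-\alpha k_1n_2+\beta k_1(2\alpha-1)\Gamma_{A_\alpha(G_2)}(\nu-2\alpha)}{1+\beta\,\Gamma_{A_\alpha(G_2)}(\nu-2\alpha)}\right)\cdot\bigl[1+\beta\,\Gamma_{A_\alpha(G_2)}(\nu-2\alpha)\bigr]^{n_1}.$$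
   Context: All graphs are simple, undirected and connected. For a graph $G$ with adjacency matrix $A(G)$ and diagonal degree matrix $D(G)$, and $0\le\alpha\le1$, $A_\alpha(G)=\alpha D(G)+(1-\alpha)A(G)$. For a square matrix $M$, $f_M(\theta)=\det(\theta I-M)$, and for an $n\times n$ matrix $M$ the $M$-coronal is $\Gamma_M(\theta)=\mathbf{j}_n^T(\theta I-M)^{-1}\mathbf{j}_n$, with $\mathbf{j}_n$ the all-ones vector. The edge corona $G_1\lozenge G_2$ is obtained by taking one copy of $G_1$ and $m_1$ copies of $G_2$ (one for each edge of $G_1$), and joining the two end vertices of the $i$-th edge of $G_1$ to every vertex of the $i$-th copy of $G_2$.
   Formalization: The formal statement additionally assumes 1+βΓ_{A_α(G_2)}(ν−2α) ≠ 0, since the displayed formula divides by this quantity, which can vanish at a ν that is not a pole (e.g. G_2=K_1, α<1, ν=3α−1). *)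

theory Defs
  imports
    "HOL-Complex_Analysis.Complex_Analysis"
    "Graph_Theory.Graph_Theory"
    "Jordan_Normal_Form.Gauss_Jordan_Elimination"
    "Jordan_Normal_Form.Determinant"
begin

text \<open>A finite simple undirected graph is a \<^const>\<open>pair_graph\<close>, i.e. a finite loop-free symmetric
  digraph without parallel arcs. An undirected edge \<open>{u, v}\<close> is the pair of arcs
  \<open>(u, v)\<close>, \<open>(v, u)\<close>, so the degree of a vertex is its out-degree.
  Connectedness is \<^const>\<open>Digraph_Component.connected\<close>, which includes that there is a vertex.\<close>

definition edge_set :: "'a pair_pre_digraph \<Rightarrow> 'a set set" where
  "edge_set G = (\<lambda>(u, v). {u, v}) ` parcs G"

definition regular_graph :: "'a pair_pre_digraph \<Rightarrow> nat \<Rightarrow> bool" where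
  "regular_graph G k \<longleftrightarrow> (\<forall>v \<in> pverts G. out_degree (with_proj G) v = k)"

definition edge_corona ::
  "'a pair_pre_digraph \<Rightarrow> 'b pair_pre_digraph \<Rightarrow> ('a + 'a set \<times> 'b) pair_pre_digraph" where
  "edge_corona G H = \<lparr>
     pverts = Inl ` pverts G \<union> Inr ` (edge_set G \<times> pverts H),
     parcs = {(Inl u, Inl v) | u v. (u, v) \<in> parcs G}
           \<union> {(Inr (e, x), Inr (e, y)) | e x y. e \<in> edge_set G \<and> (x, y) \<in> parcs H}
           \<union> {(Inl u, Inr (e, x)) | u e x. e \<in> edge_set G \<and> u \<in> e \<and> x \<in> pverts H}
           \<union> {(Inr (e, x), Inl u) | u e x. e \<in> edge_set G \<and> u \<in> e \<and> x \<in> pverts H}\<rparr>"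

text \<open>The matrices of a graph are taken with respect to an enumeration of its vertices.
  They have real entries, but are complex matrices so that the variable of characteristic
  polynomials and coronals can range over the complex numbers.\<close>

definition vertex_enum :: "'a pair_pre_digraph \<Rightarrow> 'a list \<Rightarrow> bool" where
  "vertex_enum G vs \<longleftrightarrow> distinct vs \<and> set vs = pverts G"

definition adj_matrix :: "'a pair_pre_digraph \<Rightarrow> 'a list \<Rightarrow> complex Matrix.mat" where
  "adj_matrix G vs = Matrix.mat (length vs) (length vs)
     (\<lambda>(i, j). if (vs ! i, vs ! j) \<in> parcs G then 1 else 0)"

definition deg_matrix :: "'a pair_pre_digraph \<Rightarrow> 'a list \<Rightarrow> complex Matrix.mat" where
  "deg_matrix G vs = Matrix.mat (length vs) (length vs)
     (\<lambda>(i, j). if i = j then of_nat (out_degree (with_proj G) (vs ! i)) else 0)"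

definition A_alpha :: "real \<Rightarrow> 'a pair_pre_digraph \<Rightarrow> 'a list \<Rightarrow> complex Matrix.mat" where
  "A_alpha \<alpha> G vs = complex_of_real \<alpha> \<cdot>\<^sub>m deg_matrix G vs
     + complex_of_real (1 - \<alpha>) \<cdot>\<^sub>m adj_matrix G vs"

definition char_fun :: "complex Matrix.mat \<Rightarrow> complex \<Rightarrow> complex" where
  "char_fun M \<theta> = Determinant.det (\<theta> \<cdot>\<^sub>m 1\<^sub>m (dim_row M) - M)"

definition ones_vec :: "nat \<Rightarrow> complex Matrix.vec" where
  "ones_vec n = Matrix.vec n (\<lambda>_. 1)"

text \<open>The defining expression of the coronal, with the junk value \<open>0\<close> at the finitely many
  \<open>\<theta>\<close> for which \<open>\<theta> I - M\<close> is singular.\<close>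

definition coronal_expr :: "complex Matrix.mat \<Rightarrow> complex \<Rightarrow> complex" where
  "coronal_expr M \<theta> =
     (case mat_inverse (\<theta> \<cdot>\<^sub>m 1\<^sub>m (dim_row M) - M) of
        Some B \<Rightarrow> scalar_prod (ones_vec (dim_row M)) (B *\<^sub>v ones_vec (dim_row M))
      | None \<Rightarrow> 0)"

text \<open>The coronal is a rational function of \<open>\<theta>\<close>. Not every eigenvalue of \<open>M\<close> need be a pole of it
  (for constant row sums \<open>r\<close> it is \<open>n / (\<theta> - r)\<close>); at the other eigenvalues its
  value is the limit, as provided by \<^const>\<open>remove_sings\<close>.\<close>

definition coronal :: "complex Matrix.mat \<Rightarrow> complex \<Rightarrow> complex" where
  "coronal M = remove_sings (coronal_expr M)"

end

theory Submission
  imports Defs "Jordan_Normal_Form.Char_Poly"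
begin

text \<open>Order the vertices of the edge corona as the vertices of \<open>G1\<close> followed by the copies of
  \<open>G2\<close>. Where \<open>\<nu> - 2\<alpha>\<close> is not an eigenvalue of \<open>A\<^sub>\<alpha>(G2)\<close>, the copy at an edge \<open>e\<close> is eliminated
  by a Schur complement, which contributes a factor \<open>f(\<nu> - 2\<alpha>)\<close> and subtracts
  \<open>\<beta>\<^sup>2 \<Gamma> r\<^sub>e r\<^sub>e\<^sup>T\<close> from the block of \<open>G1\<close>, where \<open>r\<^sub>e\<close> is the indicator vector of \<open>e\<close>. By regularity
  the sum of the matrices \<open>r\<^sub>e r\<^sub>e\<^sup>T\<close> is \<open>k\<^sub>1 I + A(G1)\<close>, so what remains is a multiple of a
  characteristic matrix of \<open>A\<^sub>\<alpha>(G1)\<close>. At the other admissible \<open>\<nu>\<close> the coronal, a rational function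
  without a pole there, is continuous, and both sides of the formula are compared in the limit.\<close>

section \<open>Schur complement of a block matrix\<close>

lemma det_four_block_mat_schur:
  fixes A :: "'a :: idom Matrix.mat"
  assumes A: "A \<in> carrier_mat n n" and B: "B \<in> carrier_mat n m"
    and C: "C \<in> carrier_mat m n" and D: "D \<in> carrier_mat m m"
    and E: "E \<in> carrier_mat m m" and DE: "D * E = 1\<^sub>m m"
  shows "Determinant.det (four_block_mat A B C D)
    = Determinant.det (A - B * (E * C)) * Determinant.det D"
proof -
  define W where "W = E * C"
  have W: "W \<in> carrier_mat m n" using E C by (simp add: W_def)
  let ?L = "four_block_mat (1\<^sub>m n) (0\<^sub>m n m) (- W) (1\<^sub>m m)"
  have L: "?L \<in> carrier_mat (n + m) (n + m)" by simp
  have M: "four_block_mat A B C D \<in> carrier_mat (n + m) (n + m)" using A D by simp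
  have neg: "X * (- W) = - (X * W)" if "X \<in> carrier_mat k m" for X k
    using that W by (intro eq_matI) (auto simp: scalar_prod_def sum_negf)
  have DW: "D * W = C"
    using assoc_mult_mat[OF D E C] DE C by (simp add: W_def)
  have low: "C * 1\<^sub>m n + D * (- W) = 0\<^sub>m m n"
    unfolding neg[OF D] DW using C by (intro eq_matI) auto
  have BW: "B * W \<in> carrier_mat n n" using B W by simp
  then have up: "A * 1\<^sub>m n + B * (- W) = A - B * W"
    unfolding neg[OF B] using A by (intro eq_matI) auto
  have "four_block_mat A B C D * ?L
      = four_block_mat (A * 1\<^sub>m n + B * (- W)) (A * 0\<^sub>m n m + B * 1\<^sub>m m)
          (C * 1\<^sub>m n + D * (- W)) (C * 0\<^sub>m n m + D * 1\<^sub>m m)"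
    using A B C D W by (intro mult_four_block_mat) auto
  also have "\<dots> = four_block_mat (A - B * W) B (0\<^sub>m m n) D"
    unfolding low up using A B C D by simp
  finally have "Determinant.det (four_block_mat A B C D * ?L)
      = Determinant.det (A - B * W) * Determinant.det D"
    using det_four_block_mat_lower_left_zero[OF minus_carrier_mat[OF BW] B refl D] by simp
  moreover have "Determinant.det ?L = 1"
    using W by (subst det_four_block_mat_upper_right_zero[of _ n _ m]) auto
  ultimately show ?thesis
    using det_mult[OF M L] by (simp add: W_def)
qed

section \<open>Matrices indexed by lists\<close>

text \<open>Entries depend on list elements rather than on positions, so a matrix indexed by
  vertices is described without numbering them.\<close>

definition list_mat :: "('a \<Rightarrow> 'a \<Rightarrow> 'c) \<Rightarrow> 'a list \<Rightarrow> 'c Matrix.mat" where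
  "list_mat F xs = Matrix.mat (length xs) (length xs) (\<lambda>(i, j). F (xs ! i) (xs ! j))"

lemma list_mat_carrier [simp]: "list_mat F xs \<in> carrier_mat (length xs) (length xs)"
  and dim_row_list_mat [simp]: "dim_row (list_mat F xs) = length xs"
  and dim_col_list_mat [simp]: "dim_col (list_mat F xs) = length xs"
  by (simp_all add: list_mat_def)

lemma index_list_mat [simp]:
  "i < length xs \<Longrightarrow> j < length xs \<Longrightarrow> list_mat F xs $$ (i, j) = F (xs ! i) (xs ! j)"
  by (simp add: list_mat_def)

lemma list_mat_cong:
  "(\<And>x y. x \<in> set xs \<Longrightarrow> y \<in> set xs \<Longrightarrow> F x y = G x y) \<Longrightarrow> list_mat F xs = list_mat G xs"
  by (intro eq_matI) auto

lemma list_mat_map: "list_mat F (map f xs) = list_mat (\<lambda>x y. F (f x) (f y)) xs"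
  by (intro eq_matI) auto

lemma det_list_mat_scale:
  fixes c :: "'c :: comm_ring_1"
  shows "Determinant.det (list_mat (\<lambda>x y. c * F x y) xs)
    = c ^ length xs * Determinant.det (list_mat F xs)"
proof -
  have "list_mat (\<lambda>x y. c * F x y) xs = c \<cdot>\<^sub>m list_mat F xs"
    by (intro eq_matI) auto
  then show ?thesis by simp
qed

text \<open>Rows and columns undergo the same permutation, so its sign enters twice and
  cancels.\<close>

lemma det_list_mat_reorder:
  fixes F :: "'a \<Rightarrow> 'a \<Rightarrow> 'c :: comm_ring_1"
  assumes "distinct xs" "distinct ys" "set xs = set ys"
  shows "Determinant.det (list_mat F xs) = Determinant.det (list_mat F ys)"
proof -
  from assms have "mset xs = mset ys"
    using set_eq_iff_mset_eq_distinct by blast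
  then obtain p where p: "p permutes {..<length ys}" "permute_list p ys = xs"
    by (rule mset_eq_permutation)
  let ?n = "length ys"
  have len: "length xs = ?n" using p by auto
  have p0: "p permutes {0..<?n}" using p(1) by (simp add: lessThan_atLeast0)
  have lt: "p i < ?n" if "i < ?n" for i
    using permutes_in_image[OF p(1), of i] that by simp
  have nth: "xs ! i = ys ! p i" if "i < ?n" for i
    using p that by (auto simp: permute_list_nth)
  define A where "A = list_mat F ys"
  have A: "A \<in> carrier_mat ?n ?n" by (simp add: A_def)
  \<comment> \<open>Columns are permuted as rows of the transpose: \<open>B\<close> has the entry
    \<open>A $$ (j, p i)\<close> at \<open>(i, j)\<close>. Doing the same to \<open>B\<close> gives
    \<open>A $$ (p i, p j)\<close>.\<close>
  define B where "B = Matrix.mat ?n ?n (\<lambda>(i, j). transpose_mat A $$ (p i, j))"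
  have B: "B \<in> carrier_mat ?n ?n" by (simp add: B_def)
  have dB: "Determinant.det B = signof p * Determinant.det A"
    unfolding B_def using det_permute_rows[of "transpose_mat A" ?n p] A p0
    by (simp add: det_transpose[OF A])
  have "list_mat F xs = Matrix.mat ?n ?n (\<lambda>(i, j). transpose_mat B $$ (p i, j))"
    by (intro eq_matI) (auto simp: len nth lt B_def A_def)
  then have "Determinant.det (list_mat F xs) = signof p * Determinant.det B"
    using det_permute_rows[of "transpose_mat B" ?n p] B p0 by (simp add: det_transpose[OF B])
  then show ?thesis
    by (simp add: dB A_def sign_def flip: mult.assoc of_int_mult)
qed

text \<open>The off-diagonal blocks are a 1^T and 1 b^T with 1 the all-ones vector, so the Schur
  correction is (1^T E 1) a b^T, of rank at most one. When \<open>E\<close> inverts a characteristic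
  matrix, \<open>s\<close> is a value of the coronal.\<close>

lemma det_list_mat_append_schur:
  fixes F :: "'a \<Rightarrow> 'a \<Rightarrow> 'c :: idom"
  assumes a: "\<And>x y. x \<in> set xs \<Longrightarrow> y \<in> set ys \<Longrightarrow> F x y = a x"
    and b: "\<And>x y. x \<in> set xs \<Longrightarrow> y \<in> set ys \<Longrightarrow> F y x = b x"
    and E: "E \<in> carrier_mat (length ys) (length ys)"
    and inv: "list_mat F ys * E = 1\<^sub>m (length ys)"
    and s: "s = (\<Sum>i<length ys. \<Sum>j<length ys. E $$ (i, j))"
  shows "Determinant.det (list_mat F (xs @ ys))
    = Determinant.det (list_mat (\<lambda>x y. F x y - s * (a x * b y)) xs)
      * Determinant.det (list_mat F ys)"
proof -
  let ?n = "length xs" and ?m = "length ys"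
  let ?B = "Matrix.mat ?n ?m (\<lambda>(i, j). a (xs ! i))"
  let ?C = "Matrix.mat ?m ?n (\<lambda>(i, j). b (xs ! j))"
  have split: "list_mat F (xs @ ys) = four_block_mat (list_mat F xs) ?B ?C (list_mat F ys)"
    by (intro eq_matI) (auto simp: nth_append a b)
  have "(?B * (E * ?C)) $$ (i, j) = s * (a (xs ! i) * b (xs ! j))" if "i < ?n" "j < ?n" for i j
    using that E
    by (auto simp: scalar_prod_def s sum_distrib_left sum_distrib_right lessThan_atLeast0 ac_simps
        intro!: sum.cong)
  then have "list_mat F xs - ?B * (E * ?C) = list_mat (\<lambda>x y. F x y - s * (a x * b y)) xs"
    using E by (intro eq_matI) auto
  then show ?thesis
    unfolding split using E inv by (subst det_four_block_mat_schur[of _ ?n _ ?m _ _ E]) auto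
qed

section \<open>Elimination of the copies\<close>

text \<open>The blocks \<open>P\<close>, \<open>c\<close>, \<open>Q\<close> are kept abstract so
  that eliminating one copy leaves a matrix of the same shape in which only \<open>P\<close> has
  changed.\<close>

fun corona_fun :: "('a \<Rightarrow> 'a \<Rightarrow> 'c) \<Rightarrow> ('e \<Rightarrow> 'a \<Rightarrow> 'c) \<Rightarrow> ('b \<Rightarrow> 'b \<Rightarrow> 'c)
    \<Rightarrow> 'a + 'e \<times> 'b \<Rightarrow> 'a + 'e \<times> 'b \<Rightarrow> 'c :: zero" where
  "corona_fun P c Q (Inl u) (Inl v) = P u v"
| "corona_fun P c Q (Inl u) (Inr (e, x)) = c e u"
| "corona_fun P c Q (Inr (e, x)) (Inl u) = c e u"
| "corona_fun P c Q (Inr (e, x)) (Inr (f, y)) = (if e = f then Q x y else 0)"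

definition corona_list :: "'a list \<Rightarrow> 'e list \<Rightarrow> 'b list \<Rightarrow> ('a + 'e \<times> 'b) list" where
  "corona_list us es xs = map Inl us @ concat (map (\<lambda>e. map (\<lambda>x. Inr (e, x)) xs) es)"

lemma set_corona_list: "set (corona_list us es xs) = Inl ` set us \<union> Inr ` (set es \<times> set xs)"
  by (auto simp: corona_list_def)

lemma distinct_corona_list:
  "distinct us \<Longrightarrow> distinct es \<Longrightarrow> distinct xs \<Longrightarrow> distinct (corona_list us es xs)"
  unfolding corona_list_def by (induction es) (auto simp: distinct_map inj_on_def)

text \<open>Every copy of the second graph meets the rest of the matrix only in rows and columns that are
  constant along the copy, so eliminating it is a rank one update of the first block.\<close>

lemma det_corona_fun:
  fixes Q :: "'b \<Rightarrow> 'b \<Rightarrow> 'c :: idom" and us :: "'a list" and es :: "'e list"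
  assumes E: "E \<in> carrier_mat (length xs) (length xs)"
    and inv: "list_mat Q xs * E = 1\<^sub>m (length xs)"
    and s: "s = (\<Sum>i<length xs. \<Sum>j<length xs. E $$ (i, j))"
    and "distinct es"
  shows "Determinant.det (list_mat (corona_fun P c Q) (corona_list us es xs))
    = Determinant.det (list_mat Q xs) ^ length es
      * Determinant.det (list_mat (\<lambda>u v. P u v - s * (\<Sum>e\<in>set es. c e u * c e v)) us)"
  using \<open>distinct es\<close>
\<comment> \<open>The last copy is a tail of the list, as the Schur step requires; \<open>P\<close>
  is generalized because that step replaces it by \<open>P'\<close>.\<close>
proof (induction es arbitrary: P rule: rev_induct)
  case Nil
  show ?case by (simp add: corona_list_def list_mat_map)
next
  case (snoc f es)
  let ?ys = "map (\<lambda>x. Inr (f, x)) xs :: ('a + 'e \<times> 'b) list"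
  let ?F = "corona_fun P c Q" and ?us = "corona_list us es xs"
  \<comment> \<open>Different copies are not joined, so the coupling vector vanishes on the
    remaining copies and only the first block is updated.\<close>
  define a where "a = (\<lambda>z :: 'a + 'e \<times> 'b. case z of Inl u \<Rightarrow> c f u | Inr _ \<Rightarrow> 0)"
  define P' where "P' = (\<lambda>u v. P u v - s * (c f u * c f v))"
  have f: "f \<notin> set es" and "distinct es" using snoc.prems by auto
  have Q: "list_mat ?F ?ys = list_mat Q xs" by (simp add: list_mat_map)
  have "Determinant.det (list_mat ?F (?us @ ?ys))
      = Determinant.det (list_mat (\<lambda>x y. ?F x y - s * (a x * a y)) ?us)
        * Determinant.det (list_mat ?F ?ys)"
    using f E inv s unfolding Q[symmetric]
    by (intro det_list_mat_append_schur[where E = E]) (auto simp: set_corona_list a_def)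
  also have "list_mat (\<lambda>x y. ?F x y - s * (a x * a y)) ?us = list_mat (corona_fun P' c Q) ?us"
    by (intro list_mat_cong) (auto simp: set_corona_list a_def P'_def)
  also have "Determinant.det \<dots> = Determinant.det (list_mat Q xs) ^ length es
      * Determinant.det (list_mat (\<lambda>u v. P' u v - s * (\<Sum>e\<in>set es. c e u * c e v)) us)"
    using snoc.IH \<open>distinct es\<close> .
  also have "(\<lambda>u v. P' u v - s * (\<Sum>e\<in>set es. c e u * c e v))
      = (\<lambda>u v. P u v - s * (\<Sum>e\<in>set (es @ [f]). c e u * c e v))"
    using f by (auto simp: P'_def fun_eq_iff algebra_simps)
  finally show ?case
    unfolding Q by (simp add: corona_list_def mult_ac)
qed

section \<open>Edges and degrees of a graph and of its edge corona\<close>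

lemma out_degree_with_proj:
  "out_degree (with_proj G) u = card {v. (u, v) \<in> parcs G}"
proof -
  have "out_arcs (with_proj G) u = Pair u ` {v. (u, v) \<in> parcs G}"
    by (auto simp: out_arcs_def)
  then show ?thesis
    by (simp add: out_degree_def card_image inj_on_def)
qed

context
  fixes G :: "'a pair_pre_digraph"
  assumes G: "pair_graph G"
begin

interpretation pair_graph G by (rule G)

lemma finite_edge_set: "finite (edge_set G)"
  unfolding edge_set_def using pair_finite_arcs by simp

lemma arc_commute: "(u, v) \<in> parcs G \<longleftrightarrow> (v, u) \<in> parcs G"
  using pair_sym_arcs by (auto simp: symmetric_def arcs_ends_def arc_to_ends_def elim: symE)

lemma no_loop: "(u, u) \<notin> parcs G"
  using pair_no_loops by fastforce

lemma edge_set_iff: "e \<in> edge_set G \<longleftrightarrow> (\<exists>u v. (u, v) \<in> parcs G \<and> e = {u, v})"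
  by (auto simp: edge_set_def)

lemma card_edge: "e \<in> edge_set G \<Longrightarrow> card e = 2"
  using no_loop by (auto simp: edge_set_iff card_insert_if)

text \<open>Neighbours \<open>v\<close> of \<open>u\<close> correspond bijectively to the edges
  \<open>{u, v}\<close>.\<close>

lemma card_edges_at: "card {e \<in> edge_set G. u \<in> e} = out_degree (with_proj G) u"
proof -
  have "{e \<in> edge_set G. u \<in> e} = (\<lambda>v. {u, v}) ` {v. (u, v) \<in> parcs G}"
    using arc_commute by (auto simp: edge_set_iff)
  moreover have "inj_on (\<lambda>v. {u, v}) {v. (u, v) \<in> parcs G}"
    by (auto simp: inj_on_def doubleton_eq_iff)
  ultimately show ?thesis
    by (simp add: card_image out_degree_with_proj)
qed

lemma card_edges_at2:
  assumes "u \<noteq> v"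
  shows "card {e \<in> edge_set G. u \<in> e \<and> v \<in> e} = (if (u, v) \<in> parcs G then 1 else 0)"
proof -
  have "{e \<in> edge_set G. u \<in> e \<and> v \<in> e} = (if (u, v) \<in> parcs G then {{u, v}} else {})"
    using assms arc_commute by (auto simp: edge_set_iff)
  then show ?thesis by simp
qed

end

lemma parcs_edge_corona:
  "(Inl u, Inl v) \<in> parcs (edge_corona G H) \<longleftrightarrow> (u, v) \<in> parcs G"
  "(Inl u, Inr (e, x)) \<in> parcs (edge_corona G H) \<longleftrightarrow> e \<in> edge_set G \<and> u \<in> e \<and> x \<in> pverts H"
  "(Inr (e, x), Inl u) \<in> parcs (edge_corona G H) \<longleftrightarrow> e \<in> edge_set G \<and> u \<in> e \<and> x \<in> pverts H"
  "(Inr (e, x), Inr (f, y)) \<in> parcs (edge_corona G H)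
    \<longleftrightarrow> e = f \<and> e \<in> edge_set G \<and> (x, y) \<in> parcs H"
  by (auto simp: edge_corona_def)

text \<open>Besides its old neighbours, \<open>u\<close> sees one full copy of \<open>H\<close> for
  each edge at \<open>u\<close>, and there are as many of these as neighbours.\<close>

lemma out_degree_edge_corona_Inl:
  assumes G: "pair_graph G" and H: "pair_graph H"
  shows "out_degree (with_proj (edge_corona G H)) (Inl u)
    = out_degree (with_proj G) u * (1 + card (pverts H))"
proof -
  let ?N = "{v. (u, v) \<in> parcs G}" and ?I = "{e \<in> edge_set G. u \<in> e}"
  have fin: "finite ?N" "finite ?I" "finite (pverts H)"
    using finite_edge_set[OF G] pair_fin_digraph.pair_finite_verts[of H]
      pair_fin_digraph.pair_finite_arcs[of G] G H
      finite_subset[of "Pair u ` ?N" "parcs G"]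
    by (auto simp: pair_graph_def pair_digraph_def finite_image_iff inj_on_def)
  have "{w. (Inl u, w) \<in> parcs (edge_corona G H)} = Inl ` ?N \<union> Inr ` (?I \<times> pverts H)"
    by (auto simp: edge_corona_def)
  also have "card \<dots> = card ?N + card ?I * card (pverts H)"
    using fin by (subst card_Un_disjoint) (auto simp: card_image card_cartesian_product)
  finally show ?thesis
    unfolding card_edges_at[OF G] by (simp add: out_degree_with_proj)
qed

text \<open>The two additional neighbours are the ends of \<open>e\<close>. They are the source of
  the shift by 2\<alpha> in the formula.\<close>

lemma out_degree_edge_corona_Inr:
  assumes G: "pair_graph G" and H: "pair_graph H" and e: "e \<in> edge_set G" and x: "x \<in> pverts H"
  shows "out_degree (with_proj (edge_corona G H)) (Inr (e, x)) = out_degree (with_proj H) x + 2"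
proof -
  let ?N = "{y. (x, y) \<in> parcs H}"
  have fin: "finite ?N" "finite e"
    using card_edge[OF G e] H pair_fin_digraph.pair_finite_arcs[of H]
      finite_subset[of "Pair x ` ?N" "parcs H"]
    by (auto simp: pair_graph_def pair_digraph_def finite_image_iff inj_on_def
        intro: card_ge_0_finite)
  have "{w. (Inr (e, x), w) \<in> parcs (edge_corona G H)} = (\<lambda>y. Inr (e, y)) ` ?N \<union> Inl ` e"
    using e x by (auto simp: edge_corona_def)
  also have "card \<dots> = card ?N + card e"
    using fin by (subst card_Un_disjoint) (auto simp: card_image inj_on_def)
  finally show ?thesis
    by (simp add: out_degree_with_proj card_edge[OF G e])
qed

section \<open>Characteristic matrix, coronal and their dependence on the variable\<close>

definition char_entry :: "real \<Rightarrow> 'a pair_pre_digraph \<Rightarrow> complex \<Rightarrow> 'a \<Rightarrow> 'a \<Rightarrow> complex" where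
  "char_entry \<alpha> G \<theta> u v =
     (if u = v then \<theta> - of_real \<alpha> * of_nat (out_degree (with_proj G) u) else 0)
     - (if (u, v) \<in> parcs G then of_real (1 - \<alpha>) else 0)"

lemma A_alpha_carrier [simp]: "A_alpha \<alpha> G vs \<in> carrier_mat (length vs) (length vs)"
  and dim_row_A_alpha [simp]: "dim_row (A_alpha \<alpha> G vs) = length vs"
  and dim_col_A_alpha [simp]: "dim_col (A_alpha \<alpha> G vs) = length vs"
  by (simp_all add: A_alpha_def deg_matrix_def adj_matrix_def)

lemma char_matrix_A_alpha:
  assumes "distinct vs"
  shows "\<theta> \<cdot>\<^sub>m 1\<^sub>m (length vs) - A_alpha \<alpha> G vs = list_mat (char_entry \<alpha> G \<theta>) vs"
  using assms
  by (intro eq_matI)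
    (auto simp: A_alpha_def deg_matrix_def adj_matrix_def char_entry_def nth_eq_iff_index_eq)

lemma char_fun_A_alpha:
  "distinct vs \<Longrightarrow> char_fun (A_alpha \<alpha> G vs) \<theta> = Determinant.det (list_mat (char_entry \<alpha> G \<theta>) vs)"
  by (simp add: char_fun_def char_matrix_A_alpha)

lemma coronal_expr_inverse:
  assumes M: "M \<in> carrier_mat n n" and "char_fun M \<theta> \<noteq> 0"
  obtains E where "E \<in> carrier_mat n n" "(\<theta> \<cdot>\<^sub>m 1\<^sub>m n - M) * E = 1\<^sub>m n"
    "E * (\<theta> \<cdot>\<^sub>m 1\<^sub>m n - M) = 1\<^sub>m n" "coronal_expr M \<theta> = (\<Sum>i<n. \<Sum>j<n. E $$ (i, j))"
proof -
  let ?D = "\<theta> \<cdot>\<^sub>m 1\<^sub>m n - M"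
  have n: "dim_row M = n" and D: "?D \<in> carrier_mat n n" using M by auto
  have "mat_inverse ?D \<noteq> None"
    \<comment> \<open>Both facts speak of units of the ring \<open>ring_mat\<close>;
      \<open>()\<close> fills its record extension slot so that the two rings agree.\<close>
    using mat_inverse(1)[OF D, of "()"] det_non_zero_imp_unit[OF D, of "()"] assms(2)
    unfolding char_fun_def n by blast
  then obtain E where E: "mat_inverse ?D = Some E" by blast
  note inv = mat_inverse(2)[OF D E]
  have "coronal_expr M \<theta> = (\<Sum>i<n. \<Sum>j<n. E $$ (i, j))"
    unfolding coronal_expr_def n E using inv
    by (auto simp: ones_vec_def scalar_prod_def lessThan_atLeast0 intro!: sum.cong)
  then show thesis using that inv by blast
qed

lemma char_fun_eq_poly:
  assumes M: "M \<in> carrier_mat n n"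
  shows "char_fun M \<theta> = poly (char_poly M) \<theta>"
  unfolding char_fun_def char_poly_def
  by (rule sym, rule poly_det_cong[of _ n]) (use M in \<open>auto simp: char_poly_matrix_def\<close>)

text \<open>By the adjugate formula over polynomials, the inverse of \<theta> I - M is the evaluated
  adjugate divided by the characteristic polynomial. The numerator \<open>q\<close> is the sum of
  the entries of the adjugate.\<close>

lemma coronal_expr_eq_rational:
  assumes M: "M \<in> carrier_mat n n"
  obtains q where
    "\<And>\<theta>. char_fun M \<theta> \<noteq> 0 \<Longrightarrow> coronal_expr M \<theta> = poly q \<theta> / poly (char_poly M) \<theta>"
proof -
  let ?P = "char_poly_matrix M"
  have P: "?P \<in> carrier_mat n n" using M by simp
  note adj = adj_mat[OF P]
  show thesis
  proof
    fix \<theta> assume nz: "char_fun M \<theta> \<noteq> 0"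
    let ?D = "\<theta> \<cdot>\<^sub>m 1\<^sub>m n - M" and ?ev = "map_mat (\<lambda>p. poly p \<theta>)" and ?c = "poly (char_poly M) \<theta>"
    obtain E where E: "E \<in> carrier_mat n n" and ED: "E * ?D = 1\<^sub>m n"
      and cor: "coronal_expr M \<theta> = (\<Sum>i<n. \<Sum>j<n. E $$ (i, j))"
      using coronal_expr_inverse[OF M nz] by metis
    have D: "?D \<in> carrier_mat n n" using M by auto
    have c: "?c \<noteq> 0" using nz char_fun_eq_poly[OF M] by simp
    have evP: "?ev ?P = ?D"
      using M by (intro eq_matI) (auto simp: char_poly_matrix_def)
    have A: "?ev (adj_mat ?P) \<in> carrier_mat n n" using adj(1) by simp
    have "?D * ?ev (adj_mat ?P) = ?ev (?P * adj_mat ?P)"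
      using semiring_hom.mat_hom_mult[OF poly_hom.semiring_hom_axioms P adj(1)] evP by simp
    also have "\<dots> = ?c \<cdot>\<^sub>m 1\<^sub>m n"
      unfolding adj(2) by (intro eq_matI) (auto simp: char_poly_def)
    finally have "E * (?D * ?ev (adj_mat ?P)) = E * (?c \<cdot>\<^sub>m 1\<^sub>m n)" by simp
    moreover have "E * (?D * ?ev (adj_mat ?P)) = ?ev (adj_mat ?P)"
      using assoc_mult_mat[OF E D A] ED A by simp
    moreover have "E * (?c \<cdot>\<^sub>m 1\<^sub>m n) = ?c \<cdot>\<^sub>m E"
      using E by (simp add: mult_smult_distrib[OF E one_carrier_mat])
    ultimately have eq: "?ev (adj_mat ?P) = ?c \<cdot>\<^sub>m E" by simp
    have "poly (adj_mat ?P $$ (i, j)) \<theta> = ?c * E $$ (i, j)" if "i < n" "j < n" for i j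
      using arg_cong[OF eq, of "\<lambda>X. X $$ (i, j)"] that adj(1) E by simp
    then have "poly (\<Sum>i<n. \<Sum>j<n. adj_mat ?P $$ (i, j)) \<theta> = ?c * coronal_expr M \<theta>"
      by (simp add: poly_sum cor sum_distrib_left)
    then show "coronal_expr M \<theta> = poly (\<Sum>i<n. \<Sum>j<n. adj_mat ?P $$ (i, j)) \<theta> / ?c"
      using c by simp
  qed
qed

lemma eventually_poly_nonzero:
  fixes p :: "complex poly"
  assumes "p \<noteq> 0"
  shows "eventually (\<lambda>w. poly p w \<noteq> 0) (at z)"
proof -
  \<comment> \<open>The point \<open>z\<close> may itself be a root; without it, the finite set of
    roots has an open complement containing \<open>z\<close>.\<close>
  have "finite ({w. poly p w = 0} - {z})"
    using poly_roots_finite[OF assms] by blast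
  then have "open (- ({w. poly p w = 0} - {z}))"
    by (intro open_Compl finite_imp_closed)
  then have "eventually (\<lambda>w. w \<in> - ({w. poly p w = 0} - {z}) - {z}) (at z)"
    by (intro eventually_at_in_open) auto
  then show ?thesis by eventually_elim auto
qed

lemma char_poly_nonzero:
  fixes M :: "'a :: comm_ring_1 Matrix.mat"
  assumes "M \<in> carrier_mat n n"
  shows "char_poly M \<noteq> 0"
  using degree_monic_char_poly[OF assms] by auto

lemma eventually_char_fun_nonzero:
  assumes "M \<in> carrier_mat n n"
  shows "eventually (\<lambda>w. char_fun M w \<noteq> 0) (at z)"
  using eventually_poly_nonzero[OF char_poly_nonzero[OF assms]]
  by (simp add: char_fun_eq_poly[OF assms])

text \<open>Near \<open>z\<close> the expression agrees with a rational function, so its singularity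
  is isolated and not essential. Without a pole it has a limit, which is the value assigned by
  \<open>remove_sings\<close>, whatever the default value at \<open>z\<close> is.\<close>

lemma tendsto_coronal_expr:
  assumes M: "M \<in> carrier_mat n n" and np: "\<not> is_pole (coronal M) z"
  shows "coronal_expr M \<midarrow>z\<rightarrow> coronal M z"
proof -
  obtain q where q: "\<And>\<theta>. char_fun M \<theta> \<noteq> 0 \<Longrightarrow> coronal_expr M \<theta> = poly q \<theta> / poly (char_poly M) \<theta>"
    using coronal_expr_eq_rational[OF M] by blast
  let ?r = "\<lambda>w. poly q w / poly (char_poly M) w"
  have ev: "eventually (\<lambda>w. ?r w = coronal_expr M w) (at z)"
    using eventually_char_fun_nonzero[OF M] by eventually_elim (simp add: q)
  have poly_an: "poly p analytic_on {z}" for p :: "complex poly"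
    by (rule analytic_on_subset[of _ UNIV]) (simp_all add: analytic_on_open poly_holomorphic_on)
  have "not_essential ?r z" and "isolated_singularity_at ?r z"
    by (intro not_essential_divide isolated_singularity_at_divide not_essential_analytic
        isolated_singularity_at_analytic poly_an)+
  then have ess: "not_essential (coronal_expr M) z"
    and iso: "isolated_singularity_at (coronal_expr M) z"
    using ev not_essential_transform isolated_singularity_at_transform by blast+
  \<comment> \<open>At an isolated singularity, \<open>remove_sings\<close> neither creates nor
    removes a pole.\<close>
  have "\<not> is_pole (coronal_expr M) z"
    using np iso by (simp add: coronal_def)
  then obtain c where "coronal_expr M \<midarrow>z\<rightarrow> c"
    using ess by (auto simp: not_essential_def)
  then show ?thesis
    using remove_sings_eqI by (simp add: coronal_def)
qed

section \<open>The formula away from the eigenvalues\<close>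

text \<open>Up to the factor \<open>b\<^sup>2\<close>, this is the product of the incidence matrix
  with its transpose, the signless Laplacian: it counts the edges containing both \<open>u\<close>
  and \<open>v\<close>.\<close>

lemma sum_edge_indicators:
  assumes G: "pair_graph G"
  shows "(\<Sum>e\<in>edge_set G. (if u \<in> e then b else 0) * (if v \<in> e then b else 0))
    = (b :: complex)\<^sup>2 * (if u = v then of_nat (out_degree (with_proj G) u)
        else if (u, v) \<in> parcs G then 1 else 0)"
proof -
  have "(\<Sum>e\<in>edge_set G. (if u \<in> e then b else 0) * (if v \<in> e then b else 0))
      = (\<Sum>e\<in>edge_set G. if u \<in> e \<and> v \<in> e then b\<^sup>2 else 0)"
    by (intro sum.cong) (auto simp: power2_eq_square)
  also have "\<dots> = b\<^sup>2 * of_nat (card {e \<in> edge_set G. u \<in> e \<and> v \<in> e})"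
    using finite_edge_set[OF G] by (simp add: sum.If_cases Int_def)
  finally show ?thesis
    using card_edges_at[OF G, of u] card_edges_at2[OF G, of u v] by auto
qed

text \<open>Here \<theta> I - M is invertible for M the matrix of \<open>H\<close>, so every copy
  can be eliminated and \<open>s\<close> is the true value of the coronal, not the default
  0.\<close>

lemma char_fun_edge_corona:
  fixes G :: "'a pair_pre_digraph" and H :: "'b pair_pre_digraph" and z :: complex
  assumes G: "pair_graph G" and H: "pair_graph H" and reg: "regular_graph G k"
    and us: "vertex_enum G us" and xs: "vertex_enum H xs"
    and vs: "vertex_enum (edge_corona G H) vs"
    and nz: "char_fun (A_alpha \<alpha> H xs) (z - 2 * of_real \<alpha>) \<noteq> 0"
    and s: "s = coronal_expr (A_alpha \<alpha> H xs) (z - 2 * of_real \<alpha>)"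
    and t: "1 + of_real (1 - \<alpha>) * s \<noteq> 0"
  shows "char_fun (A_alpha \<alpha> (edge_corona G H) vs) z =
    char_fun (A_alpha \<alpha> H xs) (z - 2 * of_real \<alpha>) ^ card (edge_set G)
    * char_fun (A_alpha \<alpha> G us)
        ((z - of_real \<alpha> * of_nat k * of_nat (card (pverts H))
            + of_real (1 - \<alpha>) * of_nat k * (2 * of_real \<alpha> - 1) * s)
         / (1 + of_real (1 - \<alpha>) * s))
    * (1 + of_real (1 - \<alpha>) * s) ^ card (pverts G)"
proof -
  let ?\<theta> = "z - 2 * of_real \<alpha>" and ?\<beta> = "complex_of_real (1 - \<alpha>)"
  let ?t = "1 + ?\<beta> * s"
  let ?x = "z - of_real \<alpha> * of_nat k * of_nat (card (pverts H)) + ?\<beta> * of_nat k * (2 * of_real \<alpha> - 1) * s"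
  have us': "distinct us" "set us = pverts G" and xs': "distinct xs" "set xs = pverts H"
    and vs': "distinct vs" "set vs = pverts (edge_corona G H)"
    using us xs vs by (auto simp: vertex_enum_def)
  obtain es where es: "set es = edge_set G" "distinct es"
    using finite_distinct_list[OF finite_edge_set[OF G]] by blast
  define F where "F = char_entry \<alpha> (edge_corona G H) z"
  define Q where "Q = char_entry \<alpha> H ?\<theta>"
  define P where "P = (\<lambda>u v. F (Inl u) (Inl v))"
  define c where "c = (\<lambda>e (u :: 'a). if u \<in> e then - ?\<beta> else 0)"
  obtain E where E: "E \<in> carrier_mat (length xs) (length xs)" "list_mat Q xs * E = 1\<^sub>m (length xs)"
    "s = (\<Sum>i<length xs. \<Sum>j<length xs. E $$ (i, j))"
    using coronal_expr_inverse[OF A_alpha_carrier nz] s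
    unfolding Q_def char_matrix_A_alpha[OF xs'(1)] by metis
  have F_Inl_Inr: "F (Inl u) (Inr (e, x)) = c e u"
    and F_Inr_Inl: "F (Inr (e, x)) (Inl u) = c e u"
    if "e \<in> edge_set G" "x \<in> pverts H" for u e x
    using that by (simp_all add: F_def c_def char_entry_def parcs_edge_corona)
  \<comment> \<open>A vertex of degree d in \<open>H\<close> has diagonal entry z - \<alpha> (d +
    2), which is the entry for \<open>H\<close> at z - 2\<alpha>.\<close>
  have F_Inr_Inr: "F (Inr (e, x)) (Inr (f, y)) = (if e = f then Q x y else 0)"
    if "e \<in> edge_set G" "x \<in> pverts H" for e x f y
    using that out_degree_edge_corona_Inr[OF G H that]
    by (cases "x = y"; cases "e = f")
      (simp_all add: F_def Q_def char_entry_def parcs_edge_corona algebra_simps)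
  have "char_fun (A_alpha \<alpha> (edge_corona G H) vs) z = Determinant.det (list_mat F vs)"
    by (simp add: F_def char_fun_A_alpha vs')
  also have "\<dots> = Determinant.det (list_mat F (corona_list us es xs))"
    using us' xs' vs' es
    by (intro det_list_mat_reorder distinct_corona_list) (auto simp: set_corona_list edge_corona_def)
  also have "list_mat F (corona_list us es xs)
      = list_mat (corona_fun P c Q) (corona_list us es xs)"
    by (intro list_mat_cong)
      (auto simp: set_corona_list us' xs' es P_def F_Inl_Inr F_Inr_Inl F_Inr_Inr)
  also have "Determinant.det \<dots> = Determinant.det (list_mat Q xs) ^ length es
      * Determinant.det (list_mat (\<lambda>u v. P u v - s * (\<Sum>e\<in>set es. c e u * c e v)) us)"
    using E es by (intro det_corona_fun)
  \<comment> \<open>Each arc now carries -\<beta> - s \<beta>^2 = -\<beta> \<open>?t\<close>, which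
    fixes the scale \<open>?t\<close>. The diagonal is z - \<alpha> k (1 + n) - s \<beta>^2 k with n
    the order of \<open>H\<close>; equating it with \<open>?t\<close> (y - \<alpha> k) and using
    \<beta> = 1 - \<alpha> gives y = \<open>?x / ?t\<close>.\<close>
  also have "list_mat (\<lambda>u v. P u v - s * (\<Sum>e\<in>set es. c e u * c e v)) us
      = list_mat (\<lambda>u v. ?t * char_entry \<alpha> G (?x / ?t) u v) us"
  proof (rule list_mat_cong)
    fix u v assume "u \<in> set us" "v \<in> set us"
    then have deg: "out_degree (with_proj G) u = k"
      using reg us' by (simp add: regular_graph_def)
    have P: "P u v = (if u = v then z - of_real \<alpha> * of_nat (k * (1 + card (pverts H))) else 0)
        - (if (u, v) \<in> parcs G then ?\<beta> else 0)"
      unfolding P_def F_def char_entry_def out_degree_edge_corona_Inl[OF G H] deg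
      by (simp add: edge_corona_def)
    have R: "?t * char_entry \<alpha> G (?x / ?t) u v
      = (if u = v then ?x - ?t * of_real \<alpha> * of_nat k else 0)
        - (if (u, v) \<in> parcs G then ?t * ?\<beta> else 0)"
      unfolding char_entry_def deg using t by (simp add: right_diff_distrib)
    show "P u v - s * (\<Sum>e\<in>set es. c e u * c e v) = ?t * char_entry \<alpha> G (?x / ?t) u v"
      unfolding P R es c_def sum_edge_indicators[OF G] deg
      using no_loop[OF G] by (auto simp: algebra_simps power2_eq_square)
  qed
  finally show ?thesis
    using us' xs' es distinct_card[of us] distinct_card[of es]
    by (simp add: det_list_mat_scale char_fun_A_alpha Q_def mult_ac)
qed

section \<open>Extension to all admissible points by continuity\<close>

theorem theorem4p2:
  fixes G1 :: "'a pair_pre_digraph" and G2 :: "'b pair_pre_digraph"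
    and vs1 :: "'a list" and vs2 :: "'b list" and vs :: "('a + 'a set \<times> 'b) list"
    and \<alpha> \<beta> :: real and k1 n1 m1 n2 :: nat and \<nu> :: complex
    and \<Gamma> :: "complex \<Rightarrow> complex"
  assumes "0 \<le> \<alpha>" and "\<alpha> \<le> 1" and "\<beta> = 1 - \<alpha>"
    and "pair_graph G1" and "Digraph_Component.connected (with_proj G1)"
    and "regular_graph G1 k1"
    and "card (pverts G1) = n1" and "card (edge_set G1) = m1"
    and "pair_graph G2" and "Digraph_Component.connected (with_proj G2)"
    and "card (pverts G2) = n2"
    and "vertex_enum G1 vs1" and "vertex_enum G2 vs2"
    and "vertex_enum (edge_corona G1 G2) vs"
    and "\<Gamma> = (\<lambda>z. coronal (A_alpha \<alpha> G2 vs2) (z - 2 * of_real \<alpha>))"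
    and "\<not> is_pole \<Gamma> \<nu>"
    \<comment> \<open>the quotient on the right-hand side is defined\<close>
    and "1 + of_real \<beta> * \<Gamma> \<nu> \<noteq> 0"
  shows "char_fun (A_alpha \<alpha> (edge_corona G1 G2) vs) \<nu> =
    char_fun (A_alpha \<alpha> G2 vs2) (\<nu> - 2 * of_real \<alpha>) ^ m1
    * char_fun (A_alpha \<alpha> G1 vs1)
        ((\<nu> - of_real \<alpha> * of_nat k1 * of_nat n2
            + of_real \<beta> * of_nat k1 * (2 * of_real \<alpha> - 1) * \<Gamma> \<nu>)
         / (1 + of_real \<beta> * \<Gamma> \<nu>))
    * (1 + of_real \<beta> * \<Gamma> \<nu>) ^ n1"
proof -
  define M where "M = A_alpha \<alpha> G2 vs2"
  define N where "N = A_alpha \<alpha> G1 vs1"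
  define K where "K = A_alpha \<alpha> (edge_corona G1 G2) vs"
  define g where "g = (\<lambda>z. coronal_expr M (z - 2 * of_real \<alpha>))"
  define L where "L = (\<lambda>z. char_fun K z)"
  \<comment> \<open>The coronal value is a separate argument: near \<nu> it is \<open>g z\<close>,
    while at \<nu> it is the limit \<Gamma> \<nu>, which may differ from the default value of
    \<open>g\<close> there.\<close>
  define R where "R = (\<lambda>z s. char_fun M (z - 2 * of_real \<alpha>) ^ m1
    * char_fun N ((z - of_real \<alpha> * of_nat k1 * of_nat n2
            + of_real \<beta> * of_nat k1 * (2 * of_real \<alpha> - 1) * s) / (1 + of_real \<beta> * s))
    * (1 + of_real \<beta> * s) ^ n1)"
  have M: "M \<in> carrier_mat (length vs2) (length vs2)" and N: "N \<in> carrier_mat (length vs1) (length vs1)"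
    and K: "K \<in> carrier_mat (length vs) (length vs)"
    by (simp_all add: M_def N_def K_def)
  have shift: "filtermap (\<lambda>z. z - 2 * of_real \<alpha>) (at \<nu>) = at (\<nu> - 2 * of_real \<alpha>)"
    by (rule filtermap_at_shift)
  have \<Gamma>: "\<Gamma> = coronal M \<circ> (\<lambda>z. z - 2 * of_real \<alpha>)"
    using assms(15) by (auto simp: M_def)
  have "\<not> is_pole (coronal M) (\<nu> - 2 * of_real \<alpha>)"
    using assms(16) unfolding \<Gamma> is_pole_compose_iff[OF shift] .
  then have lim: "g \<midarrow>\<nu>\<rightarrow> \<Gamma> \<nu>"
    unfolding g_def \<Gamma> comp_def
    by (intro filterlim_compose[OF tendsto_coronal_expr[OF M]]) (simp_all add: filterlim_def shift)
  have "eventually (\<lambda>z. char_fun M (z - 2 * of_real \<alpha>) \<noteq> 0) (at \<nu>)"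
    using eventually_char_fun_nonzero[OF M, of "\<nu> - 2 * of_real \<alpha>"]
    by (simp add: eventually_filtermap flip: shift)
  \<comment> \<open>The denominator is nonzero at \<nu> and hence, through this limit, at all nearby
    points.\<close>
  moreover have "((\<lambda>z. 1 + of_real \<beta> * g z) \<longlongrightarrow> 1 + of_real \<beta> * \<Gamma> \<nu>) (at \<nu>)"
    by (intro tendsto_intros lim)
  then have "eventually (\<lambda>z. 1 + of_real \<beta> * g z \<noteq> 0) (at \<nu>)"
    using assms(17) tendsto_imp_eventually_ne by blast
  ultimately have eq: "eventually (\<lambda>z. L z = R z (g z)) (at \<nu>)"
  proof eventually_elim
    case (elim z)
    then show ?case
      using char_fun_edge_corona[OF assms(4,9,6,12-14), of \<alpha> z "g z"] assms(3,7,8,11)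
      by (simp add: L_def R_def K_def M_def N_def g_def)
  qed
  \<comment> \<open>Both characteristic functions are polynomials, hence continuous, and the limit
    of the denominator is nonzero.\<close>
  have "((\<lambda>z. R z (g z)) \<longlongrightarrow> R \<nu> (\<Gamma> \<nu>)) (at \<nu>)"
    unfolding R_def char_fun_eq_poly[OF M] char_fun_eq_poly[OF N]
    by (intro tendsto_intros lim assms(17))
  then have "L \<midarrow>\<nu>\<rightarrow> R \<nu> (\<Gamma> \<nu>)"
    using tendsto_cong[OF eq] by blast
  moreover have "L \<midarrow>\<nu>\<rightarrow> L \<nu>"
    unfolding L_def char_fun_eq_poly[OF K] by (intro tendsto_intros)
  ultimately have "L \<nu> = R \<nu> (\<Gamma> \<nu>)"
    by (intro LIM_unique)
  then show ?thesis
    by (simp add: L_def R_def M_def N_def K_def)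
qed

end
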